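(* Let $0<p<1$, $q=1-p$, let $m\ge 1$ be an integer, and let $$f_k=\binom{m+k-1}{k}\left(p^m q^k+q^m p^k\right),\qquad k=0,\dots,m-1,$$ be the probability mass function of the riff-shuffle distribution with parameters $m$ and $p$. Then the sequence $(f_k)_{k=0}^{m-1}$ is unimodal, and the maximum $\max_{0\le k\le m-1} f_k$ is attained for at most two values of $k\in\{0,\dots,m-1\}$; if it is attained for two values of $k$, these are adjacent (consecutive integers).
   Context: A finite real sequence $(g_k)_{k=0}^n$ is called unimodal if there is an index $j\in\{0,\dots,n\}$ such that $g_0\le g_1\le\dots\le g_j$ and $g_j\ge g_{j+1}\ge\dots\ge g_n$. *)

theory Defs
  imports Complex_Main
begin

text \<open>Unimodality of the finite sequence \<open>g 0, \<dots>, g n\<close>; values of \<open>g\<close> beyond \<open>n\<close> are irrelevant.\<close>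

definition unimodal :: "nat \<Rightarrow> (nat \<Rightarrow> real) \<Rightarrow> bool" where
  "unimodal n g \<longleftrightarrow>
     (\<exists>j\<in>{0..n}. (\<forall>i<j. g i \<le> g (Suc i)) \<and> (\<forall>i\<in>{j..<n}. g i \<ge> g (Suc i)))"

text \<open>
  The riff-shuffle distribution lives on \<open>{0..m - 1}\<close>; only for \<open>k\<close> in this range
  (and \<open>m \<ge> 1\<close>, so that the natural-number subtraction is exact) is the formula its
  probability mass function.
\<close>

definition riff_shuffle_mass :: "nat \<Rightarrow> real \<Rightarrow> nat \<Rightarrow> real" where
  "riff_shuffle_mass m p k =
     (let q = 1 - p in real ((m + k - 1) choose k) * (p ^ m * q ^ k + q ^ m * p ^ k))"

definition max_points :: "nat \<Rightarrow> (nat \<Rightarrow> real) \<Rightarrow> nat set" where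
  "max_points n g = {k \<in> {0..n}. g k = Max (g ` {0..n})}"

end

theory Submission
  imports Defs
begin

text \<open>
  Put \<open>s = m - k\<close>, \<open>P s = p ^ s + q ^ s\<close> and \<open>W s = (p - q) * (p ^ s - q ^ s)\<close>. Since \<open>p + q = 1\<close>,
  the sign of \<open>f (k + 1) - f k\<close> is that of \<open>(s - 2) / (2 * m - s) - W s / P s\<close>. Divided by
  \<open>s\<close>, the first term is strictly increasing for \<open>s \<ge> 2\<close>, while the second is nonincreasing because
  \<open>W s / P s\<close> is \<open>c * tanh (s * artanh c)\<close> with \<open>c = p - q\<close>, concave and zero at \<open>0\<close>.
  So a weak ascent at some index forces strict ascents at all smaller indices.
\<close>

text \<open>For \<open>p \<noteq> q\<close>, dividing by \<open>(p - q)\<^sup>2\<close> turns this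
  into AM-GM: the right side becomes the sum of the \<open>2 * s + 1\<close> monomials
  \<open>p ^ i * q ^ (2 * s - i)\<close>, whose geometric mean is
  \<open>(p * q) ^ s\<close>.\<close>

lemma power_diff_ge_middle_term:
  fixes p q :: real
  assumes "0 \<le> p" "0 \<le> q"
  shows "(2 * real s + 1) * (p * q) ^ s * (p - q)\<^sup>2 \<le> (p - q) * (p ^ (2 * s + 1) - q ^ (2 * s + 1))"
proof (induction s)
  case 0
  then show ?case by (simp add: power2_eq_square)
next
  case (Suc s)
  define x y where "x = p ^ s" and "y = q ^ s"
  have pw: "p ^ (2 * s + 1) = p * x\<^sup>2" "q ^ (2 * s + 1) = q * y\<^sup>2"
    "p ^ (2 * Suc s + 1) = p ^ 3 * x\<^sup>2" "q ^ (2 * Suc s + 1) = q ^ 3 * y\<^sup>2"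
    "(p * q) ^ s = x * y" "(p * q) ^ Suc s = p * q * x * y"
    by (simp_all add: x_def y_def power_mult_distrib power_even_eq power3_eq_cube
        power2_eq_square mult_2 power_add)
  \<comment> \<open>The gap between the two sides at \<open>Suc s\<close> is \<open>p * q\<close>
    times the gap at \<open>s\<close> plus a perfect square.\<close>
  have "0 \<le> p * q * ((p - q) * (p * x\<^sup>2 - q * y\<^sup>2) - (2 * real s + 1) * (x * y) * (p - q)\<^sup>2)
      + ((p - q) * (p * x - q * y))\<^sup>2"
    using Suc assms unfolding pw by simp
  also have "\<dots> = (p - q) * (p ^ 3 * x\<^sup>2 - q ^ 3 * y\<^sup>2)
      - (2 * real (Suc s) + 1) * (p * q * x * y) * (p - q)\<^sup>2"
    by (simp add: algebra_simps power2_eq_square power3_eq_cube)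
  finally show ?case unfolding pw by simp
qed

text \<open>Division-free form of the claim that \<open>W s / (s * P s)\<close> is nonincreasing.
  The difference of the two sides is exactly the gap in the middle-term inequality.\<close>

lemma power_diff_sum_ratio_antimono:
  fixes p q :: real
  assumes "0 \<le> p" "0 \<le> q"
  shows "real s * ((p - q) * (p ^ Suc s - q ^ Suc s)) * (p ^ s + q ^ s)
    \<le> real (Suc s) * ((p - q) * (p ^ s - q ^ s)) * (p ^ Suc s + q ^ Suc s)"
proof -
  define x y where "x = p ^ s" and "y = q ^ s"
  have pw: "p ^ (2 * s + 1) = p * x\<^sup>2" "q ^ (2 * s + 1) = q * y\<^sup>2" "(p * q) ^ s = x * y"
    by (simp_all add: x_def y_def power_mult_distrib power_even_eq)
  have "0 \<le> (p - q) * (p * x\<^sup>2 - q * y\<^sup>2) - (2 * real s + 1) * (x * y) * (p - q)\<^sup>2"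
    using power_diff_ge_middle_term[OF assms, of s] unfolding pw by simp
  also have "\<dots> = real (Suc s) * ((p - q) * (x - y)) * (p * x + q * y)
      - real s * ((p - q) * (p * x - q * y)) * (x + y)"
    by (simp add: algebra_simps power2_eq_square)
  finally show ?thesis by (simp add: x_def y_def)
qed

lemma ascent_inequality_step:
  fixes p q M :: real
  assumes "0 < p" "0 < q" "2 \<le> s" "real s + 1 < M"
    and "(M - real s) * ((p - q) * (p ^ s - q ^ s)) \<le> (real s - 2) * (p ^ s + q ^ s)"
  shows "(M - real (Suc s)) * ((p - q) * (p ^ Suc s - q ^ Suc s))
    < (real (Suc s) - 2) * (p ^ Suc s + q ^ Suc s)"
proof -
  define P where "P t = p ^ t + q ^ t" for t
  define W where "W t = (p - q) * (p ^ t - q ^ t)" for t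
  define r where "r = real s"
  have Ppos: "0 < P t" for t using assms by (simp add: P_def add_pos_pos)
  have r: "2 \<le> r" "r + 1 < M" using assms by (simp_all add: r_def)
  have ratio: "r * W (Suc s) * P s \<le> (r + 1) * W s * P (Suc s)"
    using power_diff_sum_ratio_antimono[of p q s] assms by (simp add: P_def W_def r_def add.commute)
  have asc: "(M - r) * W s \<le> (r - 2) * P s"
    using assms(5) by (simp add: P_def W_def r_def)
  \<comment> \<open>The positive factor \<open>r * (M - r) * P s\<close> lets \<open>ratio\<close>
    and then \<open>asc\<close> be applied by multiplication alone.\<close>
  have "(r * (M - r) * P s) * ((M - r - 1) * W (Suc s))
      = ((M - r) * (M - r - 1)) * (r * W (Suc s) * P s)" by simp
  also have "\<dots> \<le> ((M - r) * (M - r - 1)) * ((r + 1) * W s * P (Suc s))"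
    using ratio r by (intro mult_left_mono) auto
  also have "\<dots> = ((M - r - 1) * (r + 1) * P (Suc s)) * ((M - r) * W s)" by simp
  also have "\<dots> \<le> ((M - r - 1) * (r + 1) * P (Suc s)) * ((r - 2) * P s)"
    using asc r Ppos[of "Suc s"] by (intro mult_left_mono) auto
  also have "\<dots> = ((M - r - 1) * ((r + 1) * (r - 2))) * (P s * P (Suc s))" by simp
  \<comment> \<open>Strictness enters here, as \<open>(r + 1) * (r - 2) = r * (r - 1) - 2\<close>:
    this says that \<open>(r - 2) / (r * (M - r))\<close> increases strictly. The bound
    \<open>2 \<le> r\<close> keeps the smaller product nonnegative.\<close>
  also have "\<dots> < ((M - r) * (r * (r - 1))) * (P s * P (Suc s))"
  proof (rule mult_strict_right_mono)
    show "(M - r - 1) * ((r + 1) * (r - 2)) < (M - r) * (r * (r - 1))"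
    proof (rule mult_strict_mono)
      show "(r + 1) * (r - 2) < r * (r - 1)" by (simp add: algebra_simps)
    qed (use r in auto)
  qed (use r Ppos in auto)
  also have "\<dots> = (r * (M - r) * P s) * ((r - 1) * P (Suc s))" by simp
  finally have "(M - r - 1) * W (Suc s) < (r - 1) * P (Suc s)"
    using r Ppos[of s] by (subst (asm) mult_less_cancel_left_pos) auto
  then show ?thesis by (simp add: P_def W_def r_def algebra_simps)
qed

lemma riff_shuffle_mass_diff:
  fixes p :: real
  defines "q \<equiv> 1 - p"
  assumes "k < m"
  defines "s \<equiv> m - k"
  shows "2 * real (Suc k) * (riff_shuffle_mass m p (Suc k) - riff_shuffle_mass m p k)
    = real ((m + k - 1) choose k) * (p * q) ^ k *
      ((real s - 2) * (p ^ s + q ^ s) - (2 * real m - real s) * ((p - q) * (p ^ s - q ^ s)))"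
proof -
  define x y where "x = p ^ s" and "y = q ^ s"
  define b where "b = real ((m + k - 1) choose k)"
  have m: "m = s + k" "real m = real s + real k" using assms by auto
  have "Suc k * ((m + k) choose Suc k) = (m + k) * ((m + k - 1) choose k)"
    using Suc_times_binomial_eq[of "m + k - 1" k] assms by (simp add: mult.commute)
  then have binom: "real (Suc k) * real ((m + k) choose Suc k) = real (m + k) * b"
    unfolding b_def by (metis of_nat_mult)
  have pw: "p ^ m = p ^ k * x" "q ^ m = q ^ k * y" "(p * q) ^ k = p ^ k * q ^ k"
    by (simp_all add: m(1) x_def y_def power_add power_mult_distrib)
  have mass: "riff_shuffle_mass m p k = b * (p ^ m * q ^ k + q ^ m * p ^ k)"
    "riff_shuffle_mass m p (Suc k)
      = real ((m + k) choose Suc k) * (p ^ m * (q * q ^ k) + q ^ m * (p * p ^ k))"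
    by (simp_all add: riff_shuffle_mass_def b_def q_def Let_def)
  have "2 * real (Suc k) * (riff_shuffle_mass m p (Suc k) - riff_shuffle_mass m p k)
    = 2 * (real (Suc k) * real ((m + k) choose Suc k)) * (p ^ m * (q * q ^ k) + q ^ m * (p * p ^ k))
      - 2 * real (Suc k) * b * (p ^ m * q ^ k + q ^ m * p ^ k)"
    unfolding mass by (simp only: algebra_simps)
  also have "\<dots> = b * (p ^ k * q ^ k) *
      (real (m + k) * (2 * q * x + 2 * p * y) - 2 * real (Suc k) * (x + y))"
    unfolding binom pw by (simp only: algebra_simps)
  \<comment> \<open>Use \<open>2 * q = 1 - (p - q)\<close>, \<open>2 * p = 1 + (p - q)\<close> and
    \<open>m + k = 2 * m - s\<close>; the factor 2 in the statement is there for this.\<close>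
  also have "real (m + k) * (2 * q * x + 2 * p * y) - 2 * real (Suc k) * (x + y)
      = (real s - 2) * (x + y) - (2 * real m - real s) * ((p - q) * (x - y))"
    by (simp add: q_def m(2) algebra_simps)
  finally show ?thesis by (simp add: pw b_def x_def y_def)
qed

lemma riff_shuffle_mass_ascent_backward:
  fixes p :: real
  assumes "0 < p" "p < 1" "Suc k < m - 1"
    and "riff_shuffle_mass m p (Suc k) \<le> riff_shuffle_mass m p (Suc (Suc k))"
  shows "riff_shuffle_mass m p k < riff_shuffle_mass m p (Suc k)"
proof -
  define q where "q = 1 - p"
  \<comment> \<open>This \<open>s\<close> belongs to the later index \<open>Suc k\<close>, so
    stepping back to \<open>k\<close> raises it by one. The bound \<open>Suc k < m - 1\<close>
    yields \<open>2 \<le> s\<close>.\<close>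
  define s where "s = m - Suc k"
  have s: "m - k = Suc s" "2 \<le> s" "Suc k < m" "k < m" "real s + 1 < 2 * real m"
    using assms by (auto simp: s_def)
  have q: "0 < q" using assms by (simp add: q_def)
  have c: "0 < real ((m + j - 1) choose j) * (p * q) ^ j" for j
    using q s assms by (intro mult_pos_pos) (auto simp: zero_less_binomial_iff)
  have "0 \<le> 2 * real (Suc (Suc k)) *
      (riff_shuffle_mass m p (Suc (Suc k)) - riff_shuffle_mass m p (Suc k))"
    using assms by simp
  then have "(2 * real m - real s) * ((p - q) * (p ^ s - q ^ s)) \<le> (real s - 2) * (p ^ s + q ^ s)"
    unfolding riff_shuffle_mass_diff[OF s(3)]
    using c[of "Suc k"] by (simp add: zero_le_mult_iff q_def[symmetric] s_def[symmetric])
  from ascent_inequality_step[OF assms(1) q s(2,5) this]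
  have "0 < 2 * real (Suc k) * (riff_shuffle_mass m p (Suc k) - riff_shuffle_mass m p k)"
    unfolding riff_shuffle_mass_diff[OF s(4)] s(1) q_def[symmetric]
    by (intro mult_pos_pos[OF c]) simp
  then show ?thesis by (simp add: zero_less_mult_iff)
qed

context
  fixes g :: "nat \<Rightarrow> real" and n :: nat
  assumes ascent_backward: "\<And>k. Suc k < n \<Longrightarrow> g (Suc k) \<le> g (Suc (Suc k)) \<Longrightarrow> g k < g (Suc k)"
begin

lemma strict_ascent_before_ascent:
  assumes "i < k" "k < n" "g k \<le> g (Suc k)"
  shows "g i < g (Suc i)"
  using assms
proof (induction k)
  case (Suc k)
  have "g k < g (Suc k)" using ascent_backward Suc.prems by blast
  then show ?case using Suc by (cases "i = k") auto
qed simp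

lemma unimodal_if_ascent_backward: "unimodal n g"
proof -
  \<comment> \<open>The peak is the first strict descent, or \<open>n\<close> if there is none. An
    ascent after it would force a strict ascent at \<open>j\<close> itself.\<close>
  define j where "j = (LEAST j. j = n \<or> g (Suc j) < g j)"
  have j: "j = n \<or> g (Suc j) < g j" unfolding j_def by (rule LeastI[of _ n]) simp
  have jn: "j \<le> n" unfolding j_def by (rule Least_le) simp
  have "g i \<le> g (Suc i)" if "i < j" for i
    using not_less_Least[of i "\<lambda>j. j = n \<or> g (Suc j) < g j"] that by (auto simp: j_def)
  moreover have "g i \<ge> g (Suc i)" if "i \<in> {j..<n}" for i
    using strict_ascent_before_ascent[of j i] j that by (cases "i = j") force+
  ultimately show ?thesis using jn unfolding unimodal_def by (intro bexI[of _ j]) auto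
qed

text \<open>The step into a maximum point \<open>l\<close> is a weak ascent. If it starts beyond
  \<open>k\<close>, it forces a strict ascent at \<open>k\<close>, so \<open>k\<close> is not a
  maximum point.\<close>

lemma max_points_adjacent_if_ascent_backward:
  assumes "k \<in> max_points n g" "l \<in> max_points n g" "k < l"
  shows "l = Suc k"
proof (rule ccontr)
  assume "l \<noteq> Suc k"
  then obtain i where i: "l = Suc i" "k < i" using assms(3) by (cases l) auto
  have max: "g i \<le> g x" if "x \<in> max_points n g" "i \<le> n" for x i
    using that by (auto simp: max_points_def)
  have ln: "l \<le> n" using assms(2) by (simp add: max_points_def)
  have "g i \<le> g (Suc i)" using max[OF assms(2)] i ln by simp
  then have "g k < g (Suc k)" using strict_ascent_before_ascent i ln by simp
  then show False using max[OF assms(1), of "Suc k"] i ln by simp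
qed

lemma card_max_points_if_ascent_backward: "card (max_points n g) \<le> 2"
proof (cases "max_points n g = {}")
  case False
  have fin: "finite (max_points n g)" by (simp add: max_points_def)
  define k where "k = Min (max_points n g)"
  have "l \<in> {k, Suc k}" if "l \<in> max_points n g" for l
    using max_points_adjacent_if_ascent_backward[of k l] Min_in[OF fin False] Min_le[OF fin that]
      that by (cases "k = l") (auto simp: k_def)
  then have "card (max_points n g) \<le> card {k, Suc k}" by (intro card_mono) auto
  then show ?thesis by simp
qed simp

end

theorem proposition2:
  fixes m :: nat and p :: real
  assumes "0 < p" and "p < 1" and "m \<ge> 1"
  shows "unimodal (m - 1) (riff_shuffle_mass m p)
    \<and> card (max_points (m - 1) (riff_shuffle_mass m p)) \<le> 2
    \<and> (\<forall>k\<in>max_points (m - 1) (riff_shuffle_mass m p).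
         \<forall>l\<in>max_points (m - 1) (riff_shuffle_mass m p). k < l \<longrightarrow> l = Suc k)"
  using unimodal_if_ascent_backward card_max_points_if_ascent_backward
    max_points_adjacent_if_ascent_backward riff_shuffle_mass_ascent_backward[OF assms(1,2)]
  by blast

end
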